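(* The value of $\dim_f^k(G)-k\dim_f(G)$ can be arbitrarily large, as $G$ varies, for some $k\in(1,\kappa(G)]$. That is, for every real number $N$ there exist a connected graph $G$ and a real number $k\in(1,\kappa(G)]$ such that $\dim_f^k(G)-k\dim_f(G)>N$.
   Context: All graphs are finite, simple and undirected, with at least two vertices. $d(x,y)$ is the length of a shortest path between $x$ and $y$ in $G$. For distinct $x,y\in V(G)$, let $R\{x,y\}=\{z\in V(G): d(x,z)\neq d(y,z)\}$, and let $\kappa(G)=\min\{|R\{x,y\}|: x\neq y,\ x,y\in V(G)\}$. For a function $g$ on $V(G)$ and $U\subseteq V(G)$, write $g(U)=\sum_{s\in U}g(s)$. For a real number $k\in[1,\kappa(G)]$, a function $g:V(G)\to[0,1]$ is a $k$-resolving function of $G$ if $g(R\{x,y\})\ge k$ for any two distinct vertices $x,y\in V(G)$; the fractional $k$-metric dimension is $\dim_f^k(G)=\min\{g(V(G)): g \text{ is a } k\text{-resolving function of } G\}$. The fractional metric dimension is $\dim_f(G)=\dim_f^1(G)$. *)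

theory Defs
  imports "HOL-Analysis.Analysis" "Graph_Theory.Graph_Theory"
begin

text \<open>
  A finite simple undirected graph is a term satisfying the locale predicate \<^const>\<open>graph\<close>: a finite
  symmetric digraph without loops and parallel arcs, an undirected edge being a pair of opposite
  arcs.
\<close>

text \<open>
  Distances are \<^typ>\<open>ereal\<close>-valued; all are finite if the graph is connected.
\<close>

definition graph_dist :: "('a, 'b) pre_digraph \<Rightarrow> 'a \<Rightarrow> 'a \<Rightarrow> ereal" where
  "graph_dist G x y = wf_digraph.\<mu> G (\<lambda>_. 1) x y"

definition resolving_nbhd :: "('a, 'b) pre_digraph \<Rightarrow> 'a \<Rightarrow> 'a \<Rightarrow> 'a set" where
  "resolving_nbhd G x y = {z \<in> verts G. graph_dist G x z \<noteq> graph_dist G y z}"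

definition kappa :: "('a, 'b) pre_digraph \<Rightarrow> nat" where
  "kappa G = Min {card (resolving_nbhd G x y) | x y. x \<in> verts G \<and> y \<in> verts G \<and> x \<noteq> y}"

text \<open>Only the values of \<open>g\<close> on the vertex set matter.\<close>

definition k_resolving :: "('a, 'b) pre_digraph \<Rightarrow> real \<Rightarrow> ('a \<Rightarrow> real) \<Rightarrow> bool" where
  "k_resolving G k g \<longleftrightarrow>
     (\<forall>v \<in> verts G. g v \<in> {0..1}) \<and>
     (\<forall>x \<in> verts G. \<forall>y \<in> verts G. x \<noteq> y \<longrightarrow> sum g (resolving_nbhd G x y) \<ge> k)"

definition frac_k_metric_dim :: "real \<Rightarrow> ('a, 'b) pre_digraph \<Rightarrow> real" where
  "frac_k_metric_dim k G = (LEAST w. \<exists>g. k_resolving G k g \<and> w = sum g (verts G))"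

definition frac_metric_dim :: "('a, 'b) pre_digraph \<Rightarrow> real" where
  "frac_metric_dim G = frac_k_metric_dim 1 G"

text \<open>
  The minimum defining \<^const>\<open>frac_k_metric_dim\<close> exists for every \<open>k \<le> \<kappa>(G)\<close>, so that the
  \<^const>\<open>Least\<close> operator denotes a proper value.
\<close>

lemma k_resolving_one:
  assumes "finite (verts G)" and "k \<le> real (kappa G)"
  shows "k_resolving G k (\<lambda>_. 1)"
proof -
  have "k \<le> real (card (resolving_nbhd G x y))"
    if "x \<in> verts G" "y \<in> verts G" "x \<noteq> y" for x y
  proof -
    let ?S = "{card (resolving_nbhd G x y) | x y. x \<in> verts G \<and> y \<in> verts G \<and> x \<noteq> y}"
    have "?S \<subseteq> (\<lambda>(x, y). card (resolving_nbhd G x y)) ` (verts G \<times> verts G)"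
      by auto
    then have "finite ?S"
      using assms(1) by (meson finite_SigmaI finite_imageI finite_subset)
    then have "kappa G \<le> card (resolving_nbhd G x y)"
      unfolding kappa_def using that by (intro Min_le) auto
    then show ?thesis using assms(2) by linarith
  qed
  then show ?thesis by (simp add: k_resolving_def)
qed

lemma frac_k_metric_dim_attained:
  fixes G :: "('a, 'b) pre_digraph"
  assumes fin: "finite (verts G)" and k: "k \<le> real (kappa G)"
  shows "\<exists>g. k_resolving G k g \<and> sum g (verts G) = frac_k_metric_dim k G \<and>
           (\<forall>h. k_resolving G k h \<longrightarrow> sum g (verts G) \<le> sum h (verts G))"
proof -
  let ?V = "verts G"
  let ?T = "product_topology (\<lambda>_. euclideanreal) ?V"
  let ?B = "PiE ?V (\<lambda>_. {0..1::real})"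
  define K where "K = {g \<in> ?B. k_resolving G k g}"
  define P where "P = {(x, y). x \<in> ?V \<and> y \<in> ?V \<and> x \<noteq> y}"
  have sub: "resolving_nbhd G x y \<subseteq> ?V" for x y by (auto simp: resolving_nbhd_def)
  have cont: "continuous_map ?T euclideanreal (\<lambda>g. sum g U)" if "U \<subseteq> ?V" for U
    using that fin finite_subset
    by (intro continuous_map_sum continuous_map_product_projection) auto
  have res_cong: "k_resolving G k g \<longleftrightarrow> k_resolving G k h" if "\<And>v. v \<in> ?V \<Longrightarrow> g v = h v" for g h
  proof -
    have "sum g (resolving_nbhd G x y) = sum h (resolving_nbhd G x y)" for x y
      using that sub by (intro sum.cong) auto
    then show ?thesis using that by (simp add: k_resolving_def)
  qed
  have K_eq: "K = ?B \<inter> {g \<in> topspace ?T. \<forall>p \<in> P. sum g (resolving_nbhd G (fst p) (snd p)) \<in> {k..}}"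
    unfolding K_def P_def k_resolving_def by (auto simp: PiE_iff extensional_def)
  have closed: "closedin ?T {g \<in> topspace ?T. \<forall>p \<in> P. sum g (resolving_nbhd G (fst p) (snd p)) \<in> {k..}}"
  proof (cases "P = {}")
    case False
    have "{g \<in> topspace ?T. \<forall>p \<in> P. sum g (resolving_nbhd G (fst p) (snd p)) \<in> {k..}} =
      (\<Inter>p\<in>P. {g \<in> topspace ?T. sum g (resolving_nbhd G (fst p) (snd p)) \<in> {k..}})"
      using False by auto
    moreover have "closedin ?T \<dots>"
      using False by (intro closedin_INT closedin_continuous_map_preimage[OF cont[OF sub]]) auto
    ultimately show ?thesis by (simp only:)
  next
    case True
    then have "{g \<in> topspace ?T. \<forall>p \<in> P. sum g (resolving_nbhd G (fst p) (snd p)) \<in> {k..}} = topspace ?T"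
      by blast
    then show ?thesis by (simp only: closedin_topspace)
  qed
  have "compactin ?T ?B" by (simp add: compactin_PiE)
  then have "compactin ?T K" unfolding K_eq using closed by (rule compact_Int_closedin)
  then have cpt: "compact ((\<lambda>g. sum g ?V) ` K)"
    using image_compactin[OF _ cont[OF subset_refl]] by auto
  have restr: "restrict h ?V \<in> K" if "k_resolving G k h" for h
    using that res_cong[of h "restrict h ?V"]
    unfolding K_def by (auto simp: k_resolving_def)
  have "K \<noteq> {}" using restr[OF k_resolving_one[OF assms]] by blast
  then obtain g where g: "g \<in> K" "\<forall>h \<in> K. sum g ?V \<le> sum h ?V"
    using compact_attains_inf[OF cpt] by auto
  have min: "sum g ?V \<le> sum h ?V" if "k_resolving G k h" for h
    using g(2) restr[OF that] by fastforce
  have "frac_k_metric_dim k G = sum g ?V"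
    unfolding frac_k_metric_dim_def using g(1) min
    by (intro Least_equality) (auto simp: K_def)
  then show ?thesis using g(1) min by (auto simp: K_def)
qed

end

(*
  Take the cocktail party graph with the non-adjacent pairs {x_i, y_i}, i < m, and a hub z adjacent
  to all x_i. All distances are at most 2, so a vertex resolves x and y iff it is x or y or is
  adjacent to exactly one of them. In particular R{x_i, y_i} = {x_i, y_i, z}, so for k = 3 every
  weight must be 1 and the dimension is 2m + 1. For k = 1 the weight 1 at z already resolves all
  pairs {x_i, y_i}, and every pair that z does not resolve is resolved by at least four of the other
  vertices, so the weight 1/4 suffices there and the dimension is at most 1 + m/2.
*)
theory Submission
  imports Defs
begin

section \<open>Distances and resolving sets when all distances are at most 2\<close>

lemma (in wf_digraph) graph_dist_eq_Inf_length:
  "graph_dist G x y = (INF p\<in>{p. awalk x p y}. ereal (real (length p)))"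
proof -
  have "awalk_cost (\<lambda>_. 1) p = real (length p)" for p :: "'b list"
    by (induction p) auto
  then show ?thesis by (simp add: graph_dist_def \<mu>_def)
qed

lemma (in wf_digraph) graph_dist_diameter_two:
  assumes "x \<in> verts G" "y \<in> verts G"
    and diam: "x \<noteq> y \<Longrightarrow> \<not> x \<rightarrow>\<^bsub>G\<^esub> y \<Longrightarrow> \<exists>w. x \<rightarrow>\<^bsub>G\<^esub> w \<and> w \<rightarrow>\<^bsub>G\<^esub> y"
  shows "graph_dist G x y = (if x = y then 0 else if x \<rightarrow>\<^bsub>G\<^esub> y then 1 else 2)"
proof -
  define n :: nat where "n = (if x = y then 0 else if x \<rightarrow>\<^bsub>G\<^esub> y then 1 else 2)"
  have ex: "\<exists>p. awalk x p y \<and> length p = n"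
  proof -
    consider "x = y" | "x \<noteq> y" "x \<rightarrow>\<^bsub>G\<^esub> y" | w where "x \<noteq> y" "\<not> x \<rightarrow>\<^bsub>G\<^esub> y" "x \<rightarrow>\<^bsub>G\<^esub> w" "w \<rightarrow>\<^bsub>G\<^esub> y"
      using diam by blast
    then show ?thesis
    proof cases
      case 1
      then show ?thesis
        using assms by (intro exI[of _ "[]"]) (auto simp: n_def awalk_Nil_iff)
    next
      case 2
      then obtain e where "e \<in> arcs G" "tail G e = x" "head G e = y"
        by (auto simp: arcs_ends_conv)
      then show ?thesis
        using 2 assms by (intro exI[of _ "[e]"]) (auto simp: n_def awalk_Cons_iff awalk_Nil_iff)
    next
      case 3
      then obtain e f where "e \<in> arcs G" "tail G e = x" "head G e = w"
        "f \<in> arcs G" "tail G f = w" "head G f = y"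
        by (auto simp: arcs_ends_conv)
      then show ?thesis
        using 3 assms by (intro exI[of _ "[e, f]"]) (auto simp: n_def awalk_Cons_iff awalk_Nil_iff)
    qed
  qed
  \<comment> \<open>Since \<open>n\<close> is at most 2, only walks with at most one arc could be
    shorter: the empty walk forces \<open>x = y\<close>, a single arc forces adjacency.\<close>
  have le: "n \<le> length p" if "awalk x p y" for p
  proof -
    consider "p = []" | e where "p = [e]" | "length p \<ge> 2"
      by (cases p rule: list.exhaust; cases "tl p") auto
    then show ?thesis
      using that by cases (auto simp: n_def awalk_Cons_iff awalk_Nil_iff arcs_ends_conv)
  qed
  have "graph_dist G x y = ereal (real n)"
    unfolding graph_dist_eq_Inf_length
    using ex le by (intro antisym INF_greatest) (auto intro: INF_lower2)
  then show ?thesis by (simp add: n_def)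
qed

text \<open>Each of \<open>x\<close> and \<open>y\<close> is at distance 0 from itself only; to any
  third vertex both distances are 1 or 2, so adjacency alone tells them apart.\<close>

lemma (in loopfree_digraph) resolving_nbhd_diameter_two:
  assumes "x \<in> verts G" "y \<in> verts G" "x \<noteq> y"
    and diam: "\<And>u v. u \<in> verts G \<Longrightarrow> v \<in> verts G \<Longrightarrow> u \<noteq> v \<Longrightarrow> \<not> u \<rightarrow>\<^bsub>G\<^esub> v \<Longrightarrow>
                 \<exists>w. u \<rightarrow>\<^bsub>G\<^esub> w \<and> w \<rightarrow>\<^bsub>G\<^esub> v"
  shows "resolving_nbhd G x y =
    {z \<in> verts G. z = x \<or> z = y \<or> (x \<rightarrow>\<^bsub>G\<^esub> z) \<noteq> (y \<rightarrow>\<^bsub>G\<^esub> z)}"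
proof -
  have "\<not> u \<rightarrow>\<^bsub>G\<^esub> u" for u
    using no_loops by (auto simp: arcs_ends_conv)
  moreover have "graph_dist G u v = (if u = v then 0 else if u \<rightarrow>\<^bsub>G\<^esub> v then 1 else 2)"
    if "u \<in> verts G" "v \<in> verts G" for u v
    using that diam by (rule graph_dist_diameter_two) (use that in auto)
  ultimately show ?thesis
    unfolding resolving_nbhd_def using assms(1-3)
    by (intro Collect_cong) (auto split: if_splits)
qed

section \<open>The cocktail party graph with a hub\<close>

text \<open>The hub is \<open>2 * m\<close>; the pairs are \<open>{2 * i, 2 * i + 1}\<close>, the hub being adjacent to \<open>2 * i\<close>.\<close>

definition hub_cocktail :: "nat \<Rightarrow> nat pair_pre_digraph" where
  "hub_cocktail m = \<lparr>pverts = {..2 * m},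
     parcs = {(u, v). u \<le> 2 * m \<and> v \<le> 2 * m \<and> u div 2 \<noteq> v div 2 \<and>
       (u = 2 * m \<longrightarrow> even v) \<and> (v = 2 * m \<longrightarrow> even u)}\<rparr>"

lemma hub_cocktail_simps [simp]:
  "pverts (hub_cocktail m) = {..2 * m}"
  "(u, v) \<in> parcs (hub_cocktail m) \<longleftrightarrow> u \<le> 2 * m \<and> v \<le> 2 * m \<and> u div 2 \<noteq> v div 2 \<and>
     (u = 2 * m \<longrightarrow> even v) \<and> (v = 2 * m \<longrightarrow> even u)"
  by (simp_all add: hub_cocktail_def)

lemma graph_hub_cocktail: "graph (with_proj (hub_cocktail m))"
proof -
  have "finite (parcs (hub_cocktail m))"
    by (rule finite_subset[of _ "{..2 * m} \<times> {..2 * m}"]) (auto simp: hub_cocktail_def)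
  then show ?thesis
    by unfold_locales
      (auto simp: hub_cocktail_def arc_to_ends_def symmetric_def sym_def)
qed

lemma hub_cocktail_diameter_two:
  assumes "m \<ge> 2" "u \<le> 2 * m" "v \<le> 2 * m" "u \<noteq> v" "(u, v) \<notin> parcs (hub_cocktail m)"
  shows "\<exists>w. (u, w) \<in> parcs (hub_cocktail m) \<and> (w, v) \<in> parcs (hub_cocktail m)"
proof -
  \<comment> \<open>Non-adjacent distinct vertices lie in one pair, or one of them is the hub.
    Either way a single pair \<open>i\<close> has to be avoided, and \<open>m \<ge> 2\<close> leaves
    pair 0 or pair 1. The even vertex is taken there because it is also adjacent to the hub.\<close>
  define i where "i = (if u = 2 * m then v div 2 else u div 2)"
  define w where "w = 2 * (if i = 0 then 1 else 0 :: nat)"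
  have "w div 2 \<noteq> i" "even w" "w < 2 * m" "w div 2 \<noteq> m"
    using assms(1) by (auto simp: w_def)
  moreover have "u = 2 * m \<or> v = 2 * m \<or> u div 2 = v div 2"
    using assms by auto
  ultimately have "(u, w) \<in> parcs (hub_cocktail m) \<and> (w, v) \<in> parcs (hub_cocktail m)"
    using assms(2-4) by (auto simp: i_def split: if_splits)
  then show ?thesis ..
qed

lemma connected_hub_cocktail:
  assumes "m \<ge> 2"
  shows "Digraph_Component.connected (with_proj (hub_cocktail m))"
proof -
  let ?G = "with_proj (hub_cocktail m)"
  interpret graph ?G by (rule graph_hub_cocktail)
  have "u \<rightarrow>\<^sup>*\<^bsub>?G\<^esub> v" if "u \<in> verts ?G" "v \<in> verts ?G" for u v
  proof (cases "u = v \<or> u \<rightarrow>\<^bsub>?G\<^esub> v")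
    case True
    then show ?thesis using that by auto
  next
    case False
    then have "\<exists>w. u \<rightarrow>\<^bsub>?G\<^esub> w \<and> w \<rightarrow>\<^bsub>?G\<^esub> v"
      using hub_cocktail_diameter_two[OF assms, of u v] that
      by (simp del: hub_cocktail_simps(2))
    then obtain w where "u \<rightarrow>\<^bsub>?G\<^esub> w" "w \<rightarrow>\<^bsub>?G\<^esub> v" by blast
    then show ?thesis by (meson adj_reachable_trans reachable_adjI)
  qed
  \<comment> \<open>\<open>connected\<close> means strong connectivity of the symmetric closure; the
    arcs are symmetric already, so reachability is the same.\<close>
  then have "u \<rightarrow>\<^sup>*\<^bsub>mk_symmetric ?G\<^esub> v" if "u \<in> verts ?G" "v \<in> verts ?G" for u v
    using that reachable_mk_symmetric_eq[OF sym_arcs] by auto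
  then show ?thesis
    unfolding Digraph_Component.connected_def by (intro strongly_connectedI) auto
qed

section \<open>Resolving sets of the graph and the bound on \<open>kappa\<close>\<close>

lemma resolving_nbhd_hub_cocktail:
  assumes "m \<ge> 2" "x \<le> 2 * m" "y \<le> 2 * m" "x \<noteq> y"
  shows "resolving_nbhd (with_proj (hub_cocktail m)) x y =
    {z. z \<le> 2 * m \<and> (z = x \<or> z = y \<or>
       ((x, z) \<in> parcs (hub_cocktail m)) \<noteq> ((y, z) \<in> parcs (hub_cocktail m)))}"
proof -
  interpret graph "with_proj (hub_cocktail m)" by (rule graph_hub_cocktail)
  show ?thesis
    using assms hub_cocktail_diameter_two[OF assms(1)]
    by (subst resolving_nbhd_diameter_two)
      (auto simp del: hub_cocktail_simps(2))
qed

text \<open>The two vertices of a pair have the same neighbours except for the hub, which is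
  adjacent only to the even one.\<close>

lemma resolving_nbhd_same_pair:
  assumes "m \<ge> 2" "i < m"
  shows "resolving_nbhd (with_proj (hub_cocktail m)) (2 * i) (2 * i + 1) = {2 * i, 2 * i + 1, 2 * m}"
proof -
  have "Suc (2 * i) \<noteq> 2 * m" by presburger
  then show ?thesis
    using assms by (subst resolving_nbhd_hub_cocktail) auto
qed

text \<open>The partner of \<open>x\<close> is not adjacent to \<open>x\<close>, but it is adjacent
  to \<open>y\<close>, which lies in another pair; the same holds with \<open>x\<close> and
  \<open>y\<close> exchanged.\<close>

lemma two_pairs_subset_resolving_nbhd:
  assumes "m \<ge> 2" "x < 2 * m" "y < 2 * m" "x div 2 \<noteq> y div 2"
  defines "i \<equiv> x div 2" and "j \<equiv> y div 2"
  shows "{2 * i, 2 * i + 1, 2 * j, 2 * j + 1} \<subseteq> resolving_nbhd (with_proj (hub_cocktail m)) x y"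
proof -
  have "x \<noteq> y" using assms by auto
  moreover have "x = 2 * i \<or> x = 2 * i + 1" "y = 2 * j \<or> y = 2 * j + 1"
    by (auto simp: i_def j_def)
  moreover have "i < m" "j < m" "i \<noteq> j" using assms by auto
  ultimately show ?thesis
    using assms(1-3) by (subst resolving_nbhd_hub_cocktail) auto
qed

lemma hub_in_resolving_nbhd:
  assumes "m \<ge> 2" "x \<le> 2 * m" "y \<le> 2 * m" "x \<noteq> y" "x = 2 * m \<or> y = 2 * m \<or> x div 2 = y div 2"
  shows "2 * m \<in> resolving_nbhd (with_proj (hub_cocktail m)) x y"
proof -
  \<comment> \<open>Opposite parities mean that exactly one of the two vertices of a pair is
    adjacent to the hub.\<close>
  have "even x \<noteq> even y" if "x div 2 = y div 2"
    using that assms(4) by presburger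
  then have "x = 2 * m \<or> y = 2 * m \<or> x < 2 * m \<and> y < 2 * m \<and> even x \<noteq> even y"
    using assms by auto
  then show ?thesis
    using assms by (subst resolving_nbhd_hub_cocktail) auto
qed

lemma card_resolving_nbhd_hub_cocktail:
  assumes "m \<ge> 2" "x \<le> 2 * m" "y \<le> 2 * m" "x \<noteq> y"
  shows "card (resolving_nbhd (with_proj (hub_cocktail m)) x y) \<ge> 3"
proof -
  let ?R = "resolving_nbhd (with_proj (hub_cocktail m)) x y"
  have fin: "finite ?R" by (simp add: resolving_nbhd_def)
  have xy: "x \<in> ?R" "y \<in> ?R"
    using assms by (simp_all add: resolving_nbhd_hub_cocktail)
  have "\<exists>z\<in>?R. z \<noteq> x \<and> z \<noteq> y"
  proof (cases "x = 2 * m \<or> y = 2 * m")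
    case True
    \<comment> \<open>An odd vertex outside the pair \<open>i\<close> of the non-hub vertex is
      adjacent to that vertex but not to the hub.\<close>
    define i where "i = (if x = 2 * m then y div 2 else x div 2)"
    define z where "z = 2 * (if i = 0 then 1 else 0 :: nat) + 1"
    have "odd z" "z div 2 \<noteq> i" "z < 2 * m" "z div 2 \<noteq> m"
      using assms(1) by (auto simp: z_def)
    then show ?thesis
      using True assms
      by (intro bexI[of _ z]) (auto simp: i_def resolving_nbhd_hub_cocktail split: if_splits)
  next
    case False
    show ?thesis
    proof (cases "x div 2 = y div 2")
      case True
      then show ?thesis
        using False hub_in_resolving_nbhd[OF assms] by (intro bexI[of _ "2 * m"]) auto
    next
      case neq: False
      \<comment> \<open>Here the third resolving vertex is the partner of \<open>x\<close>.\<close>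
      have sub: "{2 * (x div 2), 2 * (x div 2) + 1} \<subseteq> ?R"
        using two_pairs_subset_resolving_nbhd[of m x y] False neq assms by auto
      have "2 * (x div 2) \<noteq> x \<or> 2 * (x div 2) + 1 \<noteq> x" by auto
      moreover have "2 * (x div 2) \<noteq> y" "2 * (x div 2) + 1 \<noteq> y" using neq by auto
      ultimately show ?thesis using sub by blast
    qed
  qed
  then obtain z where "z \<in> ?R" "z \<noteq> x" "z \<noteq> y" by blast
  then have "card {x, y, z} \<le> card ?R" using xy fin by (intro card_mono) auto
  then show ?thesis using \<open>z \<noteq> x\<close> \<open>z \<noteq> y\<close> assms(4) by simp
qed

lemma kappa_hub_cocktail:
  assumes "m \<ge> 2"
  shows "kappa (with_proj (hub_cocktail m)) \<ge> 3"
proof -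
  let ?G = "with_proj (hub_cocktail m)"
  let ?S = "{card (resolving_nbhd ?G x y) | x y. x \<in> verts ?G \<and> y \<in> verts ?G \<and> x \<noteq> y}"
  have "?S \<subseteq> (\<lambda>(x, y). card (resolving_nbhd ?G x y)) ` ({..2 * m} \<times> {..2 * m})"
    by auto
  then have "finite ?S" by (rule finite_subset) auto
  \<comment> \<open>A minimum can be bounded below through its elements only if the set is
    nonempty.\<close>
  moreover have "card (resolving_nbhd ?G 0 1) \<in> ?S"
    using assms by (intro CollectI exI[of _ 0] exI[of _ 1]) auto
  ultimately show ?thesis
    unfolding kappa_def
    using card_resolving_nbhd_hub_cocktail[OF assms] by (subst Min_ge_iff) auto
qed

section \<open>Bounds on the two dimensions\<close>

lemma frac_metric_dim_hub_cocktail_le: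
  assumes "m \<ge> 2"
  shows "frac_metric_dim (with_proj (hub_cocktail m)) \<le> 1 + real m / 2"
proof -
  let ?G = "with_proj (hub_cocktail m)"
  define g :: "nat \<Rightarrow> real" where "g v = (if v = 2 * m then 1 else 1 / 4)" for v
  have "sum g (resolving_nbhd ?G x y) \<ge> 1" if "x \<le> 2 * m" "y \<le> 2 * m" "x \<noteq> y" for x y
  proof -
    let ?R = "resolving_nbhd ?G x y"
    \<comment> \<open>As \<open>g\<close> is nonnegative, a part of the resolving set of weight 1
      suffices: the hub alone, or two full pairs.\<close>
    have mono: "sum g A \<le> sum g ?R" if "A \<subseteq> ?R" for A
      using that by (intro sum_mono2) (auto simp: g_def resolving_nbhd_def)
    show ?thesis
    proof (cases "x = 2 * m \<or> y = 2 * m \<or> x div 2 = y div 2")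
      case True
      then show ?thesis
        using mono[of "{2 * m}"] hub_in_resolving_nbhd[OF assms that] by (simp add: g_def)
    next
      case False
      define i j where "i = x div 2" and "j = y div 2"
      have lt: "x < 2 * m" "y < 2 * m" "i \<noteq> j" using False that by (auto simp: i_def j_def)
      then have "sum g {2 * i, 2 * i + 1, 2 * j, 2 * j + 1} = 1"
      proof -
        have "distinct [2 * i, 2 * i + 1, 2 * j, 2 * j + 1]"
          using lt by auto
        moreover have "g v = 1 / 4" if "v \<in> {2 * i, 2 * i + 1, 2 * j, 2 * j + 1}" for v
        proof -
          have "i < m" "j < m" using lt by (auto simp: i_def j_def)
          then have "v div 2 < m" using that by auto
          then show ?thesis by (auto simp: g_def)
        qed
        then have "sum g {2 * i, 2 * i + 1, 2 * j, 2 * j + 1} =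
          (\<Sum>v\<in>{2 * i, 2 * i + 1, 2 * j, 2 * j + 1}. 1 / 4)"
          by (intro sum.cong refl)
        ultimately show ?thesis by simp
      qed
      then show ?thesis
        using mono[OF two_pairs_subset_resolving_nbhd[of m x y, folded i_def j_def]] assms lt
        by (simp add: i_def j_def)
    qed
  qed
  then have "k_resolving ?G 1 g"
    by (simp add: k_resolving_def g_def)
  moreover have "sum g {..2 * m} = 1 + real m / 2"
  proof -
    have "{..2 * m} = insert (2 * m) {..<2 * m}" by auto
    then show ?thesis by (simp add: g_def)
  qed
  \<comment> \<open>This makes the minimum exist, so that the weight of \<open>g\<close> bounds it
    from above.\<close>
  moreover have "(1::real) \<le> real (kappa ?G)"
    using kappa_hub_cocktail[OF assms] by linarith
  ultimately show ?thesis
    using frac_k_metric_dim_attained[of ?G 1] by (auto simp: frac_metric_dim_def)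
qed

lemma frac_3_metric_dim_hub_cocktail_ge:
  assumes "m \<ge> 2"
  shows "frac_k_metric_dim 3 (with_proj (hub_cocktail m)) \<ge> 2 * real m + 1"
proof -
  let ?G = "with_proj (hub_cocktail m)"
  have "(3::real) \<le> real (kappa ?G)"
    using kappa_hub_cocktail[OF assms] by linarith
  then obtain g where g: "k_resolving ?G 3 g" "sum g {..2 * m} = frac_k_metric_dim 3 ?G"
    using frac_k_metric_dim_attained[of ?G 3] by auto
  have le: "g v \<le> 1" if "v \<le> 2 * m" for v
    using g(1) that by (auto simp: k_resolving_def)
  \<comment> \<open>Three weights of at most 1 with sum at least 3 must all equal 1.\<close>
  have triple: "g (2 * i) \<ge> 1 \<and> g (2 * i + 1) \<ge> 1 \<and> g (2 * m) \<ge> 1" if "i < m" for i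
  proof -
    have "3 \<le> sum g (resolving_nbhd ?G (2 * i) (2 * i + 1))"
      using g(1) that by (auto simp: k_resolving_def)
    also have "\<dots> = g (2 * i) + g (2 * i + 1) + g (2 * m)"
    proof -
      have "2 * i \<noteq> 2 * m" "2 * i + 1 \<noteq> 2 * m" using that by auto
      then show ?thesis
        using resolving_nbhd_same_pair[OF assms that] by simp
    qed
    finally show ?thesis
      using le[of "2 * i"] le[of "2 * i + 1"] le[of "2 * m"] that by auto
  qed
  have "g v \<ge> 1" if "v \<le> 2 * m" for v
  proof (cases "v = 2 * m")
    case True
    then show ?thesis using triple[of 0] assms by simp
  next
    case False
    then have "v div 2 < m" using that by linarith
    moreover have "v = 2 * (v div 2) \<or> v = 2 * (v div 2) + 1" by linarith
    ultimately show ?thesis using triple[of "v div 2"] by metis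
  qed
  then have "(\<Sum>v\<le>2 * m. 1) \<le> sum g {..2 * m}" by (intro sum_mono) auto
  then show ?thesis using g(2) by simp
qed

theorem mainTheorem8:
  fixes N :: real
  shows "\<exists>(G :: (nat, nat \<times> nat) pre_digraph) (k :: real).
    graph G \<and> card (verts G) \<ge> 2 \<and> Digraph_Component.connected G \<and>
    k \<in> {1<..real (kappa G)} \<and>
    frac_k_metric_dim k G - k * frac_metric_dim G > N"
proof -
  \<comment> \<open>With \<open>k = 3\<close> the bounds give (2m + 1) - 3(1 + m/2) = m/2 - 2, which
    exceeds \<open>N\<close> once m > 2N + 4; adding 2 to \<open>n\<close> secures
    \<open>m \<ge> 2\<close>.\<close>
  obtain n :: nat where n: "real n > 2 * N + 4" using reals_Archimedean2 by blast
  define m where "m = n + 2"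
  have m: "m \<ge> 2" "real m > 2 * N + 4" using n by (auto simp: m_def)
  let ?G = "with_proj (hub_cocktail m)"
  have "frac_k_metric_dim 3 ?G - 3 * frac_metric_dim ?G \<ge> real m / 2 - 2"
    using frac_metric_dim_hub_cocktail_le[OF m(1)] frac_3_metric_dim_hub_cocktail_ge[OF m(1)]
    by argo
  then have "frac_k_metric_dim 3 ?G - 3 * frac_metric_dim ?G > N" using m(2) by argo
  moreover have "3 \<in> {1<..real (kappa ?G)}"
    using kappa_hub_cocktail[OF m(1)] by auto
  moreover have "card (verts ?G) \<ge> 2" using m(1) by simp
  ultimately show ?thesis
    using graph_hub_cocktail connected_hub_cocktail[OF m(1)] by blast
qed

end
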